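(* Let $q$ be a prime power and let $r,n\ge 3$ be integers with $3\mid rn$. Let $L_U$ be a maximum $2$-scattered $\mathbb{F}_q$-linear set in $\Lambda=\mathrm{PG}(r-1,q^n)$ and let $N=|L_U|=\frac{q^{rn/3}-1}{q-1}$. Then $\mathcal{C}_{L_U}$ is a three-weight code with weights $$w_0:=N-\theta_{\frac{(r-3)n}{3}-1},\qquad w_1:=N-\theta_{\frac{(r-3)n}{3}},\qquad w_2:=N-\theta_{\frac{(r-3)n}{3}+1}.$$ Its weight enumerator is $$1+t_0z^{w_0}+t_1z^{w_1}+t_2z^{w_2},$$ where $$t_0=\frac{q^{\frac{rn}{3}}-1}{(q-1)^2(q+1)(q^n-1)}\,t_0^*,\qquad t_1=\frac{\left(q^{\frac{rn}{3}}-1\right)\left(q^{\frac{rn}{3}+2}-q^{\frac{rn}{3}+1}-q^n+q^2\right)}{(q-1)^2q},\qquad t_2=\frac{(q^n-q)\left(q^{\frac{rn}{3}}-1\right)}{(q-1)^2q(q+1)},$$ and $$t_0^*=q^{\frac{2rn}{3}+3}-q^{\frac{2rn}{3}+2}-q^{\frac{2rn}{3}+1}+q^{\frac{2rn}{3}}-q^{\frac{rn}{3}+n+2}+q^{\frac{rn}{3}+3}-q^{\frac{rn}{3}+1}+q^{\frac{rn}{3}+n}+q^{2n}-q^{n+2}-q^{n+1}+q^3.$$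
   Context: Notation: $\theta_i=\frac{q^{i+1}-1}{q-1}$ for $i\ge 0$, and $\theta_{-1}=0$. Linear sets: Let $V$ be an $r$-dimensional $\mathbb{F}_{q^n}$-vector space and $\Lambda=\mathrm{PG}(V,\mathbb{F}_{q^n})=\mathrm{PG}(r-1,q^n)$. An $\mathbb{F}_q$-linear set of rank $k$ in $\Lambda$ is a point set $L_U=\{\langle u\rangle_{\mathbb{F}_{q^n}} : u\in U\setminus\{0\}\}$, where $U$ is a $k$-dimensional $\mathbb{F}_q$-subspace of $V$. For a projective subspace $\Omega=\mathrm{PG}(W,\mathbb{F}_{q^n})$ of $\Lambda$, its weight in $L_U$ is $w_{L_U}(\Omega)=\dim_{\mathbb{F}_q}(W\cap U)$. $L_U$ is $2$-scattered if $\langle L_U\rangle=\Lambda$ and every line $\ell$ of $\Lambda$ satisfies $w_{L_U}(\ell)\le 2$. A maximum $2$-scattered linear set is a $2$-scattered $\mathbb{F}_q$-linear set of rank $\frac{rn}{3}$. For $i\in\{0,1,2\}$, $t_i$ denotes the number of hyperplanes of $\Lambda$ of weight $\frac{(r-3)n}{3}+i$ in $L_U$; its value is the one displayed in the claim. Code: Write $L_U=\{\langle (g_{1i},\ldots,g_{ri})\rangle_{\mathbb{F}_{q^n}} : i\in\{1,\ldots,N\}\}$ with $N=|L_U|$ (one representative vector per point). $\mathcal{C}_{L_U}$ is the $\mathbb{F}_{q^n}$-linear code of length $N$ and dimension $r$ whose generator matrix is the $(r\times N)$-matrix having these vectors as columns. A three-weight code is a linear code whose nonzero codewords have exactly three distinct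 Hamming weights. The weight enumerator of a code of length $m$ is $1+\sum_{i=1}^m A_i^H z^i$, where $A_i^H$ is the number of codewords of Hamming weight $i$.
   Formalization: The weight enumerator is proved with coefficients (q^n-1)t_i instead of t_i, since each hyperplane gives q^n-1 nonzero codewords; as printed it fails, e.g. q=2, r=n=3: t_0+t_1+t_2=73, but the code has 511 nonzero codewords. *)

theory Defs
  imports "HOL-Analysis.Analysis" "HOL-Computational_Algebra.Polynomial"
    "HOL-Library.Function_Algebras"
begin

text \<open>
  The field with \<open>q\<close> elements is a finite field type \<open>'k\<close>, its extension of degree \<open>n\<close> is a
  finite field type \<open>'a\<close>, and the inclusion of the first into the second is a field homomorphism
  \<open>\<phi>\<close>. The ambient space \<open>V\<close> is \<open>'a ^ 'r\<close>, of dimension \<open>r = CARD('r)\<close> over \<open>'a\<close>. Projective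
  subspaces are represented by their underlying vector subspaces. Notions prefixed with
  \<open>vec.\<close> are over \<open>'a\<close>; linear algebra over \<open>'k\<close> refers to the scalar multiplication
  \<open>sub_scale \<phi>\<close>.
\<close>

definition field_embedding :: "('k::field \<Rightarrow> 'a::field) \<Rightarrow> bool" where
  "field_embedding \<phi> \<longleftrightarrow>
     \<phi> 1 = 1 \<and> (\<forall>x y. \<phi> (x + y) = \<phi> x + \<phi> y) \<and> (\<forall>x y. \<phi> (x * y) = \<phi> x * \<phi> y)"

definition sub_scale :: "('k::field \<Rightarrow> 'a::field) \<Rightarrow> 'k \<Rightarrow> 'a ^ 'r \<Rightarrow> 'a ^ 'r" where
  "sub_scale \<phi> c v = \<phi> c *s v"

lemma vector_space_sub_scale:
  assumes "field_embedding \<phi>"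
  shows "vector_space (sub_scale \<phi> :: 'k::field \<Rightarrow> 'a::field ^ 'r \<Rightarrow> 'a ^ 'r)"
  using assms
  by unfold_locales (simp_all add: field_embedding_def sub_scale_def algebra_simps vec_eq_iff)

abbreviation sub_subspace :: "('k::field \<Rightarrow> 'a::field) \<Rightarrow> ('a ^ 'r) set \<Rightarrow> bool" where
  "sub_subspace \<phi> \<equiv> module.subspace (sub_scale \<phi>)"

abbreviation sub_dim :: "('k::field \<Rightarrow> 'a::field) \<Rightarrow> ('a ^ 'r) set \<Rightarrow> nat" where
  "sub_dim \<phi> \<equiv> vector_space.dim (sub_scale \<phi>)"

definition proj_point :: "'a::field ^ 'r::finite \<Rightarrow> ('a ^ 'r) set" where
  "proj_point v = vec.span {v}"

definition linear_set :: "('a::field ^ 'r::finite) set \<Rightarrow> ('a ^ 'r) set set" where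
  "linear_set U = proj_point ` (U - {0})"

definition weight_in ::
    "('k::field \<Rightarrow> 'a::field) \<Rightarrow> ('a ^ 'r::finite) set \<Rightarrow> ('a ^ 'r) set \<Rightarrow> nat" where
  "weight_in \<phi> U W = sub_dim \<phi> (W \<inter> U)"

definition proj_line :: "('a::field ^ 'r::finite) set \<Rightarrow> bool" where
  "proj_line W \<longleftrightarrow> vec.subspace W \<and> vec.dim W = 2"

definition hyperplane :: "('a::field ^ 'r::finite) set \<Rightarrow> bool" where
  "hyperplane W \<longleftrightarrow> vec.subspace W \<and> vec.dim W = CARD('r) - 1"

definition two_scattered :: "('k::field \<Rightarrow> 'a::field) \<Rightarrow> ('a ^ 'r::finite) set \<Rightarrow> bool" where
  "two_scattered \<phi> U \<longleftrightarrow>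
     vec.span (\<Union> (linear_set U)) = UNIV \<and>
     (\<forall>W. proj_line W \<longrightarrow> weight_in \<phi> U W \<le> 2)"

text \<open>The last conjunct says that the rank is \<open>r n / 3\<close>, where \<open>n\<close> is the degree of the field
  extension.\<close>

definition maximum_two_scattered ::
    "('k::field \<Rightarrow> 'a::field) \<Rightarrow> nat \<Rightarrow> ('a ^ 'r::finite) set \<Rightarrow> bool" where
  "maximum_two_scattered \<phi> n U \<longleftrightarrow>
     sub_subspace \<phi> U \<and> two_scattered \<phi> U \<and> 3 * sub_dim \<phi> U = CARD('r) * n"

text \<open>\<open>hyperplane_count \<phi> n U i\<close> is the number \<open>t\<^sub>i\<close>.\<close>

definition hyperplane_count ::
    "('k::field \<Rightarrow> 'a::field) \<Rightarrow> nat \<Rightarrow> ('a ^ 'r::finite) set \<Rightarrow> nat \<Rightarrow> nat" where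
  "hyperplane_count \<phi> n U i =
     card {W. hyperplane W \<and> weight_in \<phi> U W = (CARD('r) - 3) * n div 3 + i}"

text \<open>The index is an integer so that \<open>\<theta>\<^bsub>-1\<^esub> = 0\<close> is covered; it is only meant for
  indices \<open>\<ge> -1\<close>, where the division is exact.\<close>

definition theta :: "nat \<Rightarrow> int \<Rightarrow> nat" where
  "theta q i = (q ^ nat (i + 1) - 1) div (q - 1)"

text \<open>A word of length \<open>m\<close> is a function on \<open>nat\<close> vanishing outside \<open>{1..m}\<close>.\<close>

definition word_scale :: "'a::field \<Rightarrow> (nat \<Rightarrow> 'a) \<Rightarrow> nat \<Rightarrow> 'a" where
  "word_scale a c = (\<lambda>i. a * c i)"

lemma vector_space_word_scale: "vector_space (word_scale :: 'a::field \<Rightarrow> _)"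
  by unfold_locales (simp_all add: word_scale_def fun_eq_iff algebra_simps)

definition linear_code :: "nat \<Rightarrow> (nat \<Rightarrow> 'a::field) set \<Rightarrow> bool" where
  "linear_code m C \<longleftrightarrow>
     module.subspace word_scale C \<and> (\<forall>c\<in>C. \<forall>i. i \<notin> {1..m} \<longrightarrow> c i = 0)"

text \<open>The generator matrix has columns \<open>g 1, \<dots>, g m\<close>; its row \<open>j\<close> is the word
  \<open>matrix_row m g j\<close>, and the code it generates is its row space.\<close>

definition matrix_row :: "nat \<Rightarrow> (nat \<Rightarrow> 'a::field ^ 'r) \<Rightarrow> 'r \<Rightarrow> nat \<Rightarrow> 'a" where
  "matrix_row m g j = (\<lambda>i. if i \<in> {1..m} then g i $ j else 0)"

definition generated_code :: "nat \<Rightarrow> (nat \<Rightarrow> 'a::field ^ 'r) \<Rightarrow> (nat \<Rightarrow> 'a) set" where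
  "generated_code m g = module.span word_scale (range (matrix_row m g))"

text \<open>\<open>g 1, \<dots>, g N\<close> is a choice of exactly one representative vector for each point of the
  linear set; injectivity of the choice is on the level of points.\<close>

definition point_representatives ::
    "('a::field ^ 'r::finite) set \<Rightarrow> nat \<Rightarrow> (nat \<Rightarrow> 'a ^ 'r) \<Rightarrow> bool" where
  "point_representatives U N g \<longleftrightarrow> bij_betw (\<lambda>i. proj_point (g i)) {1..N} (linear_set U)"

definition hamming_weight :: "nat \<Rightarrow> (nat \<Rightarrow> 'a::zero) \<Rightarrow> nat" where
  "hamming_weight m c = card {i \<in> {1..m}. c i \<noteq> 0}"

definition nonzero_weights :: "nat \<Rightarrow> (nat \<Rightarrow> 'a::zero) set \<Rightarrow> nat set" where
  "nonzero_weights m C = hamming_weight m ` (C - {0})"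

definition three_weight_code :: "nat \<Rightarrow> (nat \<Rightarrow> 'a::field) set \<Rightarrow> bool" where
  "three_weight_code m C \<longleftrightarrow> linear_code m C \<and> card (nonzero_weights m C) = 3"

definition weight_enumerator :: "nat \<Rightarrow> (nat \<Rightarrow> 'a::zero) set \<Rightarrow> int poly" where
  "weight_enumerator m C =
     1 + (\<Sum>i = 1..m. monom (int (card {c \<in> C. hamming_weight m c = i})) i)"

end

theory Submission
  imports Defs
begin

text \<open>
  Put \<open>k = rn/3\<close>, \<open>K = q\<^sup>k\<close>, \<open>Q = q\<^sup>n\<close>, and \<open>D = K/Q\<close>. The proof is a moment computation for the
  section sizes \<open>f a = |a\<^sup>\<bottom> \<inter> U|\<close>, where \<open>a\<close> ranges over the nonzero vectors of the dual space, which is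
  identified with \<open>V\<close> by the standard scalar product.

  Each \<open>f a\<close> is a power of \<open>q\<close> and at least \<open>D\<close>, because \<open>a\<close> maps \<open>U\<close> additively into a
  field with \<open>Q\<close> elements. Being 2-scattered means that at most three vectors of \<open>U\<close>
  that are independent over the small field stay independent over the large one
  (\<open>independent_over_extension\<close>); so exactly \<open>Q ^ (r - m)\<close> vectors \<open>a\<close> annihilate a given
  independent \<open>m\<close>-tuple, for \<open>m \<le> 3\<close>. Counting the pairs of a vector \<open>a\<close> and an independent \<open>m\<close>-tuple in
  \<open>a\<^sup>\<bottom> \<inter> U\<close> in two ways gives the sums of \<open>(f a - 1) \<dots> (f a - q ^ (m - 1))\<close> for all \<open>m \<le> 3\<close>
  (\<open>factorial_moment\<close>).

  The rank \<open>k = rn/3\<close> is exactly the one for which these moments make the sum of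
  \<open>(f a - D) (f a - q D) (f a - q\<^sup>2 D)\<close> vanish (\<open>cubic_moment\<close>). No term of this sum is negative,
  since \<open>f a / D\<close> is a power of \<open>q\<close>, and hence every \<open>f a\<close> is one of \<open>D\<close>, \<open>q D\<close>, \<open>q\<^sup>2 D\<close>: these are the three
  hyperplane weights. The moments of orders 0, 1 and 2 then form a linear system that
  determines the counts \<open>t\<^sub>0\<close>, \<open>t\<^sub>1\<close>, \<open>t\<^sub>2\<close> (\<open>hyperplane_counts\<close>).

  The codewords are the evaluations of the functionals \<open>a\<close> at the points of the linear set, so the
  weight of a codeword is the number of points outside \<open>a\<^sup>\<bottom>\<close>. All points have weight one, so
  the number of points in \<open>a\<^sup>\<bottom>\<close> is \<open>(f a - 1) / (q - 1)\<close>, and each hyperplane arises from \<open>Q - 1\<close> vectors \<open>a\<close>.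
\<close>

section \<open>Counting in vector spaces over a finite field\<close>

lemma (in vector_space) card_span_independent:
  assumes fin: "finite (UNIV :: 'a set)" and "finite B" "independent B"
  shows "finite (span B) \<and> card (span B) = CARD('a) ^ card B"
  using assms(2,3)
proof (induction B rule: finite_induct)
  case empty
  then show ?case by simp
next
  case (insert b B)
  then have b: "b \<notin> span B" and ind: "independent B"
    by (auto simp: independent_insert)
  have "bij_betw (\<lambda>(c, y). scale c b + y) (UNIV \<times> span B) (span (insert b B))"
  proof (rule bij_betw_imageI)
    show "inj_on (\<lambda>(c, y). scale c b + y) (UNIV \<times> span B)"
    proof (rule inj_onI, clarsimp)
      fix c y d z assume yz: "y \<in> span B" "z \<in> span B" and eq: "scale c b + y = scale d b + z"
      then have "scale (c - d) b = z - y"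
        by (simp add: scale_left_diff_distrib algebra_simps)
      then have "scale (c - d) b \<in> span B"
        using yz by (simp add: span_diff)
      then have "scale (inverse (c - d)) (scale (c - d) b) \<in> span B"
        by (rule span_scale)
      with b have "c = d"
        by (cases "c = d") auto
      with eq show "c = d \<and> y = z" by simp
    qed
    show "(\<lambda>(c, y). scale c b + y) ` (UNIV \<times> span B) = span (insert b B)"
    proof
      show "(\<lambda>(c, y). scale c b + y) ` (UNIV \<times> span B) \<subseteq> span (insert b B)"
        by (auto intro!: span_add span_scale intro: span_base span_mono[THEN subsetD])
      show "span (insert b B) \<subseteq> (\<lambda>(c, y). scale c b + y) ` (UNIV \<times> span B)"
        by (force simp: span_insert image_iff)
    qed
  qed
  from bij_betw_same_card[OF this] bij_betw_finite[OF this] insert ind fin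
  show ?case by (simp add: card_cartesian_product)
qed

lemma (in vector_space) card_subspace:
  assumes fin: "finite (UNIV :: 'a set)" and S: "subspace S" "finite S"
  shows "card S = CARD('a) ^ dim S"
proof -
  obtain B where B: "B \<subseteq> S" "independent B" "S \<subseteq> span B" "card B = dim S"
    by (rule basis_exists)
  then have "span B = S" using S(1) span_minimal by blast
  moreover have "finite B" using B(1) S(2) finite_subset by blast
  ultimately show ?thesis using card_span_independent[OF fin _ B(2)] B(4) by metis
qed

text \<open>Lists are used because ordered tuples can be counted one entry at a time: the next vector must
  avoid a span whose size is known.\<close>
definition (in vector_space) independent_lists :: "nat \<Rightarrow> 'b set \<Rightarrow> 'b list set" where
  "independent_lists m S = {xs. length xs = m \<and> distinct xs \<and> independent (set xs) \<and> set xs \<subseteq> S}"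

text \<open>The product also covers lists longer than the dimension of \<open>S\<close>, where a factor vanishes; this is why the
  count is stated over the integers.\<close>
lemma (in vector_space) card_independent_lists:
  assumes fin: "finite (UNIV :: 'a set)" and S: "subspace S" "finite S"
  shows "int (card (independent_lists m S)) = (\<Prod>i<m. int (card S) - int CARD('a) ^ i)"
proof (induction m)
  case 0
  have "independent_lists 0 S = {[]}" by (auto simp: independent_lists_def independent_empty)
  then show ?case by simp
next
  case (Suc m)
  have finite_lists: "finite (independent_lists m S)"
    by (rule finite_subset[OF _ finite_lists_length_eq[OF S(2), of m]])
      (auto simp: independent_lists_def)
  have "independent_lists (Suc m) S
      = (\<lambda>(xs, u). u # xs) ` (SIGMA xs : independent_lists m S. S - span (set xs))"
    (is "?L = ?R")
  proof
    show "?L \<subseteq> ?R"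
    proof
      fix ys assume "ys \<in> ?L"
      then obtain u xs where "ys = u # xs" "length xs = m" "distinct xs" "u \<notin> set xs"
          "independent (insert u (set xs))" "u \<in> S" "set xs \<subseteq> S"
        by (auto simp: independent_lists_def length_Suc_conv)
      then have "(xs, u) \<in> (SIGMA xs : independent_lists m S. S - span (set xs))"
        unfolding independent_lists_def independent_insert by simp
      then show "ys \<in> ?R" unfolding \<open>ys = u # xs\<close> by (rule rev_image_eqI) simp
    qed
    show "?R \<subseteq> ?L"
      unfolding independent_lists_def using span_base independent_insertI by force
  qed
  moreover have "inj_on (\<lambda>(xs, u). u # xs)
      (SIGMA xs : independent_lists m S. S - span (set xs))"
    by (auto intro: inj_onI)
  ultimately have "card (independent_lists (Suc m) S)
      = (\<Sum>xs\<in>independent_lists m S. card (S - span (set xs)))"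
    using S(2) finite_lists by (simp add: card_image)
  then have "int (card (independent_lists (Suc m) S))
      = (\<Sum>xs\<in>independent_lists m S. int (card (S - span (set xs))))"
    by simp
  also have "\<dots> = (\<Sum>xs\<in>independent_lists m S. int (card S) - int CARD('a) ^ m)"
  proof (rule sum.cong[OF refl])
    fix xs assume xs: "xs \<in> independent_lists m S"
    then have sub: "span (set xs) \<subseteq> S"
      unfolding independent_lists_def using span_minimal[OF _ S(1)] by blast
    have "card (span (set xs)) = CARD('a) ^ m"
      using card_span_independent[OF fin, of "set xs"] xs
      by (auto simp: independent_lists_def distinct_card)
    with sub show "int (card (S - span (set xs))) = int (card S) - int CARD('a) ^ m"
      using card_mono[OF S(2) sub] finite_subset[OF sub S(2)] by (simp add: card_Diff_subset of_nat_diff)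
  qed
  also have "\<dots> = (\<Prod>i<Suc m. int (card S) - int CARD('a) ^ i)"
    using Suc.IH by (simp add: mult.commute)
  finally show ?case .
qed

section \<open>Annihilators and hyperplanes\<close>

definition annihilator :: "('a::field ^ 'r::finite) set \<Rightarrow> ('a ^ 'r) set" where
  "annihilator T = {a. \<forall>v\<in>T. scalar_product a v = 0}"

lemma scalar_product_commute: "scalar_product (a::'a::field ^ 'r::finite) v = scalar_product v a"
  by (simp add: scalar_product_def mult.commute)

lemma subspace_annihilator: "vec.subspace (annihilator T)"
  by (auto simp: vec.subspace_def annihilator_def scalar_product_def algebra_simps sum.distrib
      simp flip: sum_distrib_left)

lemma card_vec_space: "CARD('a::{field,finite} ^ 'r::finite) = CARD('a) ^ CARD('r)"
  using vec.card_subspace[of "UNIV :: ('a^'r) set"] by (simp add: vec_dim_card)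

lemma scalar_product_eq_0_iff:
  fixes a :: "'a::field ^ 'r::finite"
  shows "(\<forall>v. scalar_product a v = 0) \<longleftrightarrow> a = 0"
proof
  assume "\<forall>v. scalar_product a v = 0"
  then have "scalar_product a (axis i 1) = 0" for i by blast
  then have "a $ i = 0" for i
    by (simp add: scalar_product_def axis_def if_distrib cong: if_cong)
  then show "a = 0" by (simp add: vec_eq_iff)
qed (simp add: scalar_product_def)

lemma annihilator_span: "annihilator (vec.span T) = annihilator T"
proof
  show "annihilator (vec.span T) \<subseteq> annihilator T"
    by (auto simp: annihilator_def vec.span_base)
  show "annihilator T \<subseteq> annihilator (vec.span T)"
  proof
    fix a assume a: "a \<in> annihilator T"
    then have "T \<subseteq> annihilator {a}"
      by (auto simp: annihilator_def scalar_product_commute)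
    then have "vec.span T \<subseteq> annihilator {a}"
      by (rule vec.span_minimal[OF _ subspace_annihilator])
    then show "a \<in> annihilator (vec.span T)"
      by (auto simp: annihilator_def scalar_product_commute)
  qed
qed

text \<open>Extend \<open>T\<close> to a basis \<open>B\<close>. A vector is determined by its scalar products with \<open>B\<close>, and a comparison of
  cardinalities shows that these can be prescribed freely; annihilating \<open>T\<close> fixes \<open>card T\<close> of them.\<close>
lemma card_annihilator:
  fixes T :: "('a::{field,finite} ^ 'r::finite) set"
  assumes T: "vec.independent T"
  shows "card (annihilator T) = CARD('a) ^ (CARD('r) - card T)"
proof -
  obtain B where B: "T \<subseteq> B" "vec.independent B" "vec.span B = UNIV"
    using vec.maximal_independent_subset_extend[OF subset_UNIV T] by (metis top.extremum_uniqueI)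
  have card_B: "card B = CARD('r)"
    unfolding vec_dim_card[symmetric, where 'a = 'a]
    by (rule vec.basis_card_eq_dim) (use B in auto)
  define F where "F a = restrict (scalar_product a) B" for a :: "'a ^ 'r"
  have inj: "inj F"
  proof (rule injI)
    fix a b assume "F a = F b"
    then have "scalar_product a v = scalar_product b v" if "v \<in> B" for v
      using that by (metis F_def restrict_apply')
    then have "a - b \<in> annihilator B"
      by (simp add: annihilator_def scalar_product_def left_diff_distrib sum_subtractf)
    then have "a - b \<in> annihilator UNIV"
      using annihilator_span[of B] B(3) by simp
    then show "a = b"
      using scalar_product_eq_0_iff[of "a - b"] by (simp add: annihilator_def)
  qed
  have "card (range F) = card (B \<rightarrow>\<^sub>E (UNIV :: 'a set))"
    using inj card_B by (simp add: card_image card_vec_space card_PiE)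
  moreover have "range F \<subseteq> B \<rightarrow>\<^sub>E UNIV" by (auto simp: F_def)
  ultimately have range: "range F = B \<rightarrow>\<^sub>E UNIV"
    by (intro card_subset_eq) (auto intro: finite_PiE)
  let ?P = "PiE B (\<lambda>b. if b \<in> T then {0} else UNIV :: 'a set)"
  have "F ` annihilator T = ?P"
  proof
    show "F ` annihilator T \<subseteq> ?P"
      by (auto simp: F_def annihilator_def)
    show "?P \<subseteq> F ` annihilator T"
    proof
      fix f assume f: "f \<in> ?P"
      then have "f \<in> range F" unfolding range by auto
      then obtain a where a: "f = F a" by blast
      have "scalar_product a v = 0" if "v \<in> T" for v
        using PiE_mem[OF f, of v] that B(1) by (auto simp: a F_def)
      then show "f \<in> F ` annihilator T" by (auto simp: a annihilator_def)
    qed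
  qed
  then have "card (annihilator T) = card ?P"
    using card_image[of F "annihilator T"] inj by (metis inj_on_subset subset_UNIV)
  also have "\<dots> = (\<Prod>b\<in>B. if b \<in> T then 1 else CARD('a))"
    by (simp add: card_PiE if_distrib cong: if_cong)
  also have "\<dots> = CARD('a) ^ card (B - T)"
    by (subst prod.If_cases) (simp_all add: Diff_eq)
  also have "card (B - T) = CARD('r) - card T"
    using B(1) card_B by (simp add: card_Diff_subset)
  finally show ?thesis .
qed

lemma card_field_gt_1: "1 < CARD('a::{field,finite})"
proof -
  have "card {0, 1 :: 'a} \<le> CARD('a)" by (intro card_mono) auto
  then show ?thesis by simp
qed

lemma hyperplane_annihilator:
  fixes a :: "'a::{field,finite} ^ 'r::finite"
  assumes "a \<noteq> 0"
  shows "hyperplane (annihilator {a})"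
proof -
  have "vec.independent {a}" using assms by simp
  from card_annihilator[OF this]
  have "CARD('a) ^ vec.dim (annihilator {a}) = CARD('a) ^ (CARD('r) - 1)"
    using vec.card_subspace[OF _ subspace_annihilator, of "{a}"] by simp
  then show ?thesis
    using card_field_gt_1[where 'a = 'a] by (simp add: hyperplane_def subspace_annihilator)
qed

lemma card_normals_of_hyperplane:
  fixes W :: "('a::{field,finite} ^ 'r::finite) set"
  assumes W: "hyperplane W"
  shows "card {a. a \<noteq> 0 \<and> annihilator {a} = W} = CARD('a) - 1"
proof -
  have sub: "vec.subspace W" and dim: "vec.dim W = CARD('r) - 1"
    using W by (auto simp: hyperplane_def)
  obtain B where B: "B \<subseteq> W" "vec.independent B" "W \<subseteq> vec.span B" "card B = vec.dim W"
    by (rule vec.basis_exists)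
  have "annihilator W = annihilator B"
    using B(1,3) sub annihilator_span[of B] vec.span_minimal[OF B(1) sub] by (metis subset_antisym)
  then have card: "card (annihilator W) = CARD('a)"
    using card_annihilator[OF B(2)] B(4) dim by (simp add: Suc_leI)
  have "{a. a \<noteq> 0 \<and> annihilator {a} = W} = annihilator W - {0}"
  proof
    show "{a. a \<noteq> 0 \<and> annihilator {a} = W} \<subseteq> annihilator W - {0}"
      by (auto simp: annihilator_def scalar_product_commute)
    show "annihilator W - {0} \<subseteq> {a. a \<noteq> 0 \<and> annihilator {a} = W}"
    proof
      fix a assume a: "a \<in> annihilator W - {0}"
      then have "W \<subseteq> annihilator {a}"
        by (auto simp: annihilator_def scalar_product_commute)
      moreover have "hyperplane (annihilator {a})" using a hyperplane_annihilator by auto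
      ultimately have "W = annihilator {a}"
        using sub dim by (intro vec.subspace_dim_equal) (auto simp: hyperplane_def)
      then show "a \<in> {a. a \<noteq> 0 \<and> annihilator {a} = W}" using a by auto
    qed
  qed
  moreover have "0 \<in> annihilator W" by (rule vec.subspace_0[OF subspace_annihilator])
  ultimately show ?thesis using card by simp
qed

section \<open>Maximum 2-scattered subspaces\<close>

locale max_two_scattered =
  fixes \<phi> :: "'k::{field,finite} \<Rightarrow> 'a::{field,finite}"
    and q n k :: nat
    and U :: "('a ^ 'r::finite) set"
  assumes card_base: "CARD('k) = q" and card_ext: "CARD('a) = q ^ n"
    and rank_def: "sub_dim \<phi> U = k" and embedding: "field_embedding \<phi>"
    and r_ge: "CARD('r) \<ge> 3"
    and n_ge: "n \<ge> 3"
    and max_scattered: "maximum_two_scattered \<phi> n U"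
begin

text \<open>The prefix \<open>sub\<close> marks linear algebra over the small field, as opposed to \<open>vec\<close> over the
  large one.\<close>
sublocale sub: vector_space "sub_scale \<phi> :: 'k \<Rightarrow> 'a ^ 'r \<Rightarrow> 'a ^ 'r"
  using embedding by (rule vector_space_sub_scale)

abbreviation cut :: "'a ^ 'r \<Rightarrow> nat" where "cut a \<equiv> card (annihilator {a} \<inter> U)"

lemma subspace_U: "sub.subspace U"
  and rank: "3 * k = CARD('r) * n"
  using max_scattered rank_def by (auto simp: maximum_two_scattered_def)

lemma line_weight: "proj_line W \<Longrightarrow> weight_in \<phi> U W \<le> 2"
  using max_scattered by (auto simp: maximum_two_scattered_def two_scattered_def)

lemma q_gt_1: "1 < q"
  using card_field_gt_1[where 'a = 'k] card_base by simp

lemma n_le_k: "n \<le> k"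
proof -
  have "3 * n \<le> CARD('r) * n" using r_ge by (intro mult_right_mono) auto
  then show ?thesis using rank by linarith
qed

lemma subspace_restrict: "vec.subspace W \<Longrightarrow> sub.subspace W"
  unfolding sub.subspace_def vec.subspace_def sub_scale_def by blast

lemma card_subspace_base: "sub.subspace S \<Longrightarrow> card S = q ^ sub_dim \<phi> S"
  using sub.card_subspace[of S] card_base by simp

lemma card_U: "card U = q ^ k"
  using card_subspace_base[OF subspace_U] rank_def by simp

lemma card_cut:
  assumes "vec.subspace W"
  shows "card (W \<inter> U) = q ^ weight_in \<phi> U W"
  unfolding weight_in_def
  by (intro card_subspace_base sub.subspace_inter subspace_restrict subspace_U assms)

text \<open>Since \<open>U\<close> has dimension at least 3, a smaller independent set can be enlarged to three vectors. If these
  were dependent over the large field, they would lie on a line, which would then have weight at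
  least 3.\<close>
lemma independent_over_extension:
  assumes T: "T \<subseteq> U" "sub.independent T" "card T \<le> 3"
  shows "vec.independent T"
proof -
  obtain B where B: "T \<subseteq> B" "B \<subseteq> U" "sub.independent B" "U \<subseteq> sub.span B"
    using sub.maximal_independent_subset_extend[OF T(1,2)] by auto
  have "card B = k" using sub.basis_card_eq_dim[OF B(2,4,3)] rank_def by simp
  then have "3 \<le> card B" using n_ge n_le_k by linarith
  then obtain S where S: "T \<subseteq> S" "S \<subseteq> B" "card S = 3"
    using exists_subset_between[OF T(3) _ B(1)] by auto
  have "vec.independent S"
  proof
    assume dep: "vec.dependent S"
    obtain b where b: "b \<in> S" "b \<in> vec.span (S - {b})"
      using dep unfolding vec.dependent_def by blast
    have "vec.dim (vec.span S) \<le> card (S - {b})"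
    proof (rule vec.dim_le_card)
      have "S \<subseteq> vec.span (S - {b})" using b(2) by (auto intro: vec.span_base)
      then show "vec.span S \<subseteq> vec.span (S - {b})" by (simp add: vec.span_minimal)
    qed simp
    then have dim: "vec.dim S \<le> 2" using S(3) b(1) by simp
    obtain B1 where B1: "B1 \<subseteq> S" "vec.independent B1" "S \<subseteq> vec.span B1" "card B1 = vec.dim S"
      by (rule vec.basis_exists)
    obtain B2 where B2: "B1 \<subseteq> B2" "vec.independent B2" "vec.span B2 = UNIV"
      using vec.maximal_independent_subset_extend[OF subset_UNIV B1(2)]
      by (metis top.extremum_uniqueI)
    have card_B2: "card B2 = CARD('r)"
      unfolding vec_dim_card[symmetric, where 'a = 'a]
      by (rule vec.basis_card_eq_dim) (use B2 in auto)
    obtain L where L: "B1 \<subseteq> L" "L \<subseteq> B2" "card L = 2"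
      using exists_subset_between[of B1 2 B2] dim B1(4) B2(1) r_ge card_B2 by auto
    have "vec.dim (vec.span L) = 2"
      using vec.dim_span_eq_card_independent[OF vec.independent_mono[OF B2(2) L(2)]] L(3) by simp
    then have "proj_line (vec.span L)"
      unfolding proj_line_def by (simp only: vec.subspace_span simp_thms)
    then have w: "weight_in \<phi> U (vec.span L) \<le> 2" by (rule line_weight)
    have "S \<subseteq> vec.span L \<inter> U"
      using B1(3) vec.span_mono[OF L(1)] S(2) B(2) by blast
    moreover obtain E where E: "S \<subseteq> E" "E \<subseteq> vec.span L \<inter> U" "sub.independent E"
        "vec.span L \<inter> U \<subseteq> sub.span E"
      using sub.maximal_independent_subset_extend[OF calculation sub.independent_mono[OF B(3) S(2)]]
      by auto
    moreover have "card E = weight_in \<phi> U (vec.span L)"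
      unfolding weight_in_def using sub.basis_card_eq_dim[OF E(2,4,3)] .
    moreover have "card S \<le> card E" using E(1) by (simp add: card_mono)
    ultimately show False using w S(3) by simp
  qed
  then show ?thesis using S(1) by (rule vec.independent_mono)
qed

section \<open>The moments of the hyperplane sections\<close>

text \<open>This is a double count of pairs of a functional and an independent \<open>m\<close>-tuple of \<open>U\<close> that it
  annihilates; the zero functional is then removed, which accounts for the subtracted 1.\<close>
lemma factorial_moment:
  assumes m: "m \<le> 3"
  shows "(\<Sum>a\<in>UNIV - {0}. \<Prod>i<m. int (cut a) - int q ^ i)
    = (\<Prod>i<m. int q ^ k - int q ^ i) * ((int q ^ n) ^ (CARD('r) - m) - 1)"
proof -
  let ?L = "sub.independent_lists m U"
  have finL: "finite ?L"
    by (rule finite_subset[OF _ finite_lists_length_eq[of U m]])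
      (auto simp: sub.independent_lists_def)
  have lists: "int (card ?L) = (\<Prod>i<m. int q ^ k - int q ^ i)"
    using sub.card_independent_lists[OF _ subspace_U] by (simp add: card_U card_base)
  have cut: "(\<Prod>i<m. int (cut a) - int q ^ i) = (\<Sum>xs \<in> {xs \<in> ?L. set xs \<subseteq> annihilator {a}}. 1)"
    for a
  proof -
    have "sub.subspace (annihilator {a} \<inter> U)"
      by (intro sub.subspace_inter subspace_restrict subspace_annihilator subspace_U)
    from sub.card_independent_lists[OF _ this, of m]
    have "(\<Prod>i<m. int (cut a) - int q ^ i)
        = int (card (sub.independent_lists m (annihilator {a} \<inter> U)))"
      by (simp add: card_base)
    also have "sub.independent_lists m (annihilator {a} \<inter> U)
        = {xs \<in> ?L. set xs \<subseteq> annihilator {a}}"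
      by (auto simp: sub.independent_lists_def)
    finally show ?thesis by simp
  qed
  have "(\<Sum>a\<in>UNIV. \<Prod>i<m. int (cut a) - int q ^ i)
      = (\<Sum>a\<in>UNIV. \<Sum>xs \<in> {xs \<in> ?L. set xs \<subseteq> annihilator {a}}. 1)"
    by (simp only: cut)
  also have "\<dots> = (\<Sum>xs\<in>?L. \<Sum>a \<in> {a \<in> UNIV. set xs \<subseteq> annihilator {a}}. 1)"
    by (rule sum.swap_restrict) (simp_all add: finL)
  also have "\<dots> = (\<Sum>xs\<in>?L. (int q ^ n) ^ (CARD('r) - m))"
  proof (rule sum.cong[OF refl])
    fix xs assume xs: "xs \<in> ?L"
    then have c: "card (set xs) = m" by (auto simp: sub.independent_lists_def distinct_card)
    then have "vec.independent (set xs)"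
      using xs m by (intro independent_over_extension) (auto simp: sub.independent_lists_def)
    from card_annihilator[OF this]
    have "card (annihilator (set xs)) = (q ^ n) ^ (CARD('r) - m)" by (simp add: c card_ext)
    moreover have "{a \<in> UNIV. set xs \<subseteq> annihilator {a}} = annihilator (set xs)"
      by (auto simp: annihilator_def scalar_product_commute)
    ultimately show "(\<Sum>a \<in> {a \<in> UNIV. set xs \<subseteq> annihilator {a}}. 1)
        = (int q ^ n) ^ (CARD('r) - m)" by simp
  qed
  also have "\<dots> = (\<Prod>i<m. int q ^ k - int q ^ i) * (int q ^ n) ^ (CARD('r) - m)"
    by (simp add: lists)
  finally have all: "(\<Sum>a\<in>UNIV. \<Prod>i<m. int (cut a) - int q ^ i)
      = (\<Prod>i<m. int q ^ k - int q ^ i) * (int q ^ n) ^ (CARD('r) - m)" .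
  have "cut 0 = q ^ k"
    using card_U by (simp add: annihilator_def scalar_product_def)
  then show ?thesis
    using all by (simp add: sum_diff1 algebra_simps)
qed

text \<open>The fibres of \<open>a\<close> on \<open>U\<close> are translates of its kernel, and there are at most \<open>q ^ n\<close>
  of them.\<close>
lemma cut_lower:
  obtains i where "cut a = q ^ (k - n) * q ^ i" "weight_in \<phi> U (annihilator {a}) = k - n + i"
proof -
  let ?w = "weight_in \<phi> U (annihilator {a})"
  have cut: "cut a = q ^ ?w" by (rule card_cut) (rule subspace_annihilator)
  have "card U \<le> (\<Sum>c\<in>(UNIV :: 'a set). card {u \<in> U. scalar_product a u = c})"
  proof -
    have "card (\<Union>c. {u \<in> U. scalar_product a u = c})
        \<le> (\<Sum>c\<in>(UNIV :: 'a set). card {u \<in> U. scalar_product a u = c})"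
      by (rule card_UN_le) simp
    moreover have "(\<Union>c. {u \<in> U. scalar_product a u = c}) = U" by auto
    ultimately show ?thesis by simp
  qed
  also have "\<dots> \<le> (\<Sum>c\<in>(UNIV :: 'a set). cut a)"
  proof (rule sum_mono)
    fix c
    show "card {u \<in> U. scalar_product a u = c} \<le> cut a"
    proof (cases "\<exists>u\<in>U. scalar_product a u = c")
      case True
      then obtain u where u: "u \<in> U" "scalar_product a u = c" by blast
      show ?thesis
      proof (rule card_inj_on_le[of "\<lambda>v. v - u"])
        show "(\<lambda>v. v - u) ` {u \<in> U. scalar_product a u = c} \<subseteq> annihilator {a} \<inter> U"
          using u sub.subspace_diff[OF subspace_U]
          by (auto simp: annihilator_def scalar_product_commute[of _ a])
            (simp add: scalar_product_def right_diff_distrib sum_subtractf)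
      qed (auto intro: inj_onI)
    next
      case False
      then have empty: "{u \<in> U. scalar_product a u = c} = {}" by blast
      show ?thesis unfolding empty by simp
    qed
  qed
  finally have "q ^ k \<le> q ^ (n + ?w)"
    by (simp add: card_U card_ext cut power_add)
  then have "k - n \<le> ?w" using q_gt_1 by simp
  then have "?w = k - n + (?w - (k - n))" by simp
  then show thesis using that[of "?w - (k - n)"] cut by (metis power_add)
qed

text \<open>Expressing every power of \<open>Q\<close> through \<open>D\<close> and \<open>Q\<close> alone, by means of \<open>rn = 3k\<close>, turns the moments into
  polynomials, so that the later identities hold in a polynomial ring and need no division.\<close>
lemma power_sizes:
  defines "D \<equiv> int q ^ (k - n)" and "Q \<equiv> int q ^ n"
  shows "int q ^ k = D * Q" "Q ^ CARD('r) = (D * Q) ^ 3"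
    "Q ^ (CARD('r) - 1) = D * (D * Q)\<^sup>2" "Q ^ (CARD('r) - 2) = D\<^sup>2 * (D * Q)"
    "Q ^ (CARD('r) - 3) = D ^ 3"
proof -
  show K: "int q ^ k = D * Q" using n_le_k by (simp add: D_def Q_def flip: power_add)
  have "Q ^ CARD('r) = (int q ^ k) ^ 3"
    using rank by (simp only: Q_def power_mult[symmetric] mult.commute)
  then show R: "Q ^ CARD('r) = (D * Q) ^ 3" by (simp add: K)
  have Q: "Q \<noteq> 0" using q_gt_1 by (simp add: Q_def)
  have split: "Q ^ (CARD('r) - m) * Q ^ m = (D * Q) ^ 3" if "m \<le> 3" for m
  proof -
    have "CARD('r) - m + m = CARD('r)" using that r_ge by simp
    then show ?thesis using R by (simp only: power_add[symmetric])
  qed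
  show "Q ^ (CARD('r) - 1) = D * (D * Q)\<^sup>2"
    using split[of 1] Q by (simp add: power3_eq_cube power2_eq_square algebra_simps)
  show "Q ^ (CARD('r) - 2) = D\<^sup>2 * (D * Q)"
    using split[of 2] Q by (simp add: power3_eq_cube power2_eq_square algebra_simps)
  show "Q ^ (CARD('r) - 3) = D ^ 3"
    using split[of 3] Q by (simp add: power_mult_distrib)
qed

lemma low_moments:
  defines "D \<equiv> int q ^ (k - n)" and "Q \<equiv> int q ^ n"
  shows "(\<Sum>a\<in>UNIV - {0 :: 'a ^ 'r}. 1) = (D * Q) ^ 3 - 1"
    and "(\<Sum>a\<in>UNIV - {0}. int (cut a) - 1) = (D * Q - 1) * (D * (D * Q)\<^sup>2 - 1)"
    and "(\<Sum>a\<in>UNIV - {0}. (int (cut a) - 1) * (int (cut a) - int q))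
      = (D * Q - 1) * (D * Q - int q) * (D\<^sup>2 * (D * Q) - 1)"
    and "(\<Sum>a\<in>UNIV - {0}. (int (cut a) - 1) * (int (cut a) - int q) * (int (cut a) - (int q)\<^sup>2))
      = (D * Q - 1) * (D * Q - int q) * (D * Q - (int q)\<^sup>2) * (D ^ 3 - 1)"
proof -
  have prods: "(\<Prod>i<0. F i) = 1" "(\<Prod>i<1. F i) = F 0" "(\<Prod>i<2. F i) = F 0 * F 1"
      "(\<Prod>i<3. F i) = F 0 * F 1 * F 2" for F :: "nat \<Rightarrow> int"
    by (simp_all add: numeral_2_eq_2 numeral_3_eq_3)
  note sizes = prods power_sizes diff_zero power_0 power_one_right mult_1
  have le: "(0::nat) \<le> 3" "(1::nat) \<le> 3" "(2::nat) \<le> 3" "(3::nat) \<le> 3" by simp_all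
  show "(\<Sum>a\<in>UNIV - {0 :: 'a ^ 'r}. 1) = (D * Q) ^ 3 - 1"
    unfolding D_def Q_def by (rule factorial_moment[OF le(1), unfolded sizes])
  show "(\<Sum>a\<in>UNIV - {0}. int (cut a) - 1) = (D * Q - 1) * (D * (D * Q)\<^sup>2 - 1)"
    unfolding D_def Q_def by (rule factorial_moment[OF le(2), unfolded sizes])
  show "(\<Sum>a\<in>UNIV - {0}. (int (cut a) - 1) * (int (cut a) - int q))
      = (D * Q - 1) * (D * Q - int q) * (D\<^sup>2 * (D * Q) - 1)"
    unfolding D_def Q_def by (rule factorial_moment[OF le(3), unfolded sizes])
  show "(\<Sum>a\<in>UNIV - {0}. (int (cut a) - 1) * (int (cut a) - int q) * (int (cut a) - (int q)\<^sup>2))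
      = (D * Q - 1) * (D * Q - int q) * (D * Q - (int q)\<^sup>2) * (D ^ 3 - 1)"
    unfolding D_def Q_def by (rule factorial_moment[OF le(4), unfolded sizes])
qed

text \<open>The cubic is a combination of the polynomials whose sums are the moments of orders 0 to 3. The sum
  vanishes by a polynomial identity in \<open>D\<close>, \<open>Q\<close> and \<open>q\<close>. It depends on \<open>Q ^ r = K ^ 3\<close>, and this is where
  the rank \<open>rn/3\<close> enters.\<close>
lemma cubic_moment:
  defines "D \<equiv> int q ^ (k - n)"
  shows "(\<Sum>a\<in>UNIV - {0}. (int (cut a) - D) * (int (cut a) - int q * D)
      * (int (cut a) - (int q)\<^sup>2 * D)) = 0"
proof -
  define p where "p = int q"
  define Q where "Q = p ^ n"
  \<comment> \<open>The coefficients of the expansion, found by comparing the powers of \<open>f\<close> from the top down.\<close>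
  define c2 where "c2 = (1 + p + p\<^sup>2) * (1 - D)"
  define c1 where "c1 = (p + p\<^sup>2 + p ^ 3) * (D\<^sup>2 - 1) + (1 + p) * c2"
  define c0 where "c0 = p ^ 3 * (1 - D ^ 3) - p * c2 + c1"
  have expand: "(f - D) * (f - p * D) * (f - p\<^sup>2 * D)
      = (f - 1) * (f - p) * (f - p\<^sup>2) + c2 * ((f - 1) * (f - p)) + c1 * (f - 1) + c0 * 1" for f
    unfolding c0_def c1_def c2_def by algebra
  have "(\<Sum>a\<in>UNIV - {0}. (int (cut a) - D) * (int (cut a) - p * D) * (int (cut a) - p\<^sup>2 * D))
      = (\<Sum>a\<in>UNIV - {0}. (int (cut a) - 1) * (int (cut a) - p) * (int (cut a) - p\<^sup>2))
        + c2 * (\<Sum>a\<in>UNIV - {0}. (int (cut a) - 1) * (int (cut a) - p))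
        + c1 * (\<Sum>a\<in>UNIV - {0}. int (cut a) - 1) + c0 * (\<Sum>a\<in>UNIV - {0 :: 'a ^ 'r}. 1)"
    unfolding expand sum.distrib sum_distrib_left ..
  also have "\<dots> = (D * Q - 1) * (D * Q - p) * (D * Q - p\<^sup>2) * (D ^ 3 - 1)
      + c2 * ((D * Q - 1) * (D * Q - p) * (D\<^sup>2 * (D * Q) - 1))
      + c1 * ((D * Q - 1) * (D * (D * Q)\<^sup>2 - 1)) + c0 * ((D * Q) ^ 3 - 1)"
    unfolding p_def Q_def D_def low_moments ..
  also have "\<dots> = 0"
    unfolding c0_def c1_def c2_def by algebra
  finally show ?thesis by (simp add: p_def)
qed

text \<open>With \<open>f = q ^ i D\<close>, the factors of the cubic are multiples of \<open>q ^ i - q ^ j\<close> for \<open>j < 3\<close>: one of them is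
  zero if \<open>i < 3\<close>, and all are positive otherwise. A vanishing sum therefore excludes
  \<open>i \<ge> 3\<close>.\<close>
lemma hyperplane_weights:
  assumes "a \<noteq> 0"
  obtains i where "i < 3" "cut a = q ^ (k - n) * q ^ i"
    "weight_in \<phi> U (annihilator {a}) = k - n + i"
proof -
  define D where "D = int q ^ (k - n)"
  define p where "p = int q"
  let ?c = "\<lambda>a. (int (cut a) - D) * (int (cut a) - p * D) * (int (cut a) - p\<^sup>2 * D)"
  have D: "D > 0" and p: "p > 1" using q_gt_1 by (simp_all add: D_def p_def)
  have pos: "?c b > 0" if "cut b = q ^ (k - n) * q ^ i" "3 \<le> i" for b i
  proof -
    have cut: "int (cut b) = p ^ i * D" using that(1) by (simp add: D_def p_def)
    have "p ^ j < p ^ i" if "j < 3" for j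
      using that \<open>3 \<le> i\<close> p by (intro power_strict_increasing) auto
    from this[of 0] this[of 1] this[of 2] have "1 < p ^ i" "p < p ^ i" "p\<^sup>2 < p ^ i" by auto
    then have "D < p ^ i * D" "p * D < p ^ i * D" "p\<^sup>2 * D < p ^ i * D" using D by simp_all
    then show ?thesis unfolding cut by simp
  qed
  have nonneg: "?c b \<ge> 0" for b
  proof -
    obtain i where i: "cut b = q ^ (k - n) * q ^ i" by (rule cut_lower)
    then have cut: "int (cut b) = p ^ i * D" by (simp add: D_def p_def)
    consider "i = 0" | "i = 1" | "i = 2" | "3 \<le> i" by linarith
    then show ?thesis
    proof cases
      case 4
      with pos[OF i] show ?thesis by simp
    qed (simp_all add: cut)
  qed
  have "(\<Sum>a\<in>UNIV - {0}. ?c a) = 0" using cubic_moment by (simp add: D_def p_def)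
  then have "?c a = 0"
    using nonneg assms by (subst (asm) sum_nonneg_eq_0_iff) auto
  moreover obtain i where i: "cut a = q ^ (k - n) * q ^ i"
      "weight_in \<phi> U (annihilator {a}) = k - n + i" by (rule cut_lower)
  ultimately have "i < 3" using pos[OF i(1)] by (metis less_irrefl not_le)
  with i that show thesis by blast
qed

section \<open>The hyperplane counts\<close>

abbreviation t :: "nat \<Rightarrow> nat" where "t \<equiv> hyperplane_count \<phi> n U"

lemma generic_weight: "(CARD('r) - 3) * n div 3 = k - n"
proof -
  have "(CARD('r) - 3) * n = 3 * (k - n)" using rank by (simp add: diff_mult_distrib)
  then show ?thesis by simp
qed

text \<open>A hyperplane determines its normal vector up to a nonzero scalar of the large field.\<close>
lemma card_normals:
  "card {a. a \<noteq> 0 \<and> weight_in \<phi> U (annihilator {a}) = k - n + i} = (q ^ n - 1) * t i"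
proof -
  let ?A = "{a. a \<noteq> 0 \<and> weight_in \<phi> U (annihilator {a}) = k - n + i}"
  let ?H = "{W. hyperplane W \<and> weight_in \<phi> U W = k - n + i}"
  have "card ?A = (\<Sum>a\<in>?A. 1)" by simp
  also have "\<dots> = (\<Sum>W\<in>?H. \<Sum>a\<in>{a \<in> ?A. annihilator {a} = W}. 1)"
    by (rule sum.group[symmetric]) (auto simp: hyperplane_annihilator)
  also have "\<dots> = (\<Sum>W\<in>?H. q ^ n - 1)"
  proof (rule sum.cong[OF refl])
    fix W assume W: "W \<in> ?H"
    then have "{a \<in> ?A. annihilator {a} = W} = {a. a \<noteq> 0 \<and> annihilator {a} = W}" by auto
    then show "(\<Sum>a\<in>{a \<in> ?A. annihilator {a} = W}. 1) = q ^ n - 1"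
      using card_normals_of_hyperplane[of W] W card_ext by simp
  qed
  finally show ?thesis by (simp add: hyperplane_count_def generic_weight)
qed

lemma sum_over_cuts:
  fixes F :: "int \<Rightarrow> int"
  shows "(\<Sum>a\<in>UNIV - {0}. F (int (cut a)))
    = (\<Sum>i<3. (int q ^ n - 1) * int (t i) * F (int q ^ (k - n) * int q ^ i))"
proof -
  let ?w = "\<lambda>a. weight_in \<phi> U (annihilator {a}) - (k - n)"
  have "(\<Sum>a\<in>UNIV - {0}. F (int (cut a)))
      = (\<Sum>i<3. \<Sum>a\<in>{a \<in> UNIV - {0}. ?w a = i}. F (int (cut a)))"
  proof (rule sum.group[symmetric])
    show "?w ` (UNIV - {0}) \<subseteq> {..<3}"
    proof (rule image_subsetI)
      fix a :: "'a ^ 'r" assume "a \<in> UNIV - {0}"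
      then have "a \<noteq> 0" by simp
      then obtain i where "i < 3" "weight_in \<phi> U (annihilator {a}) = k - n + i"
        by (rule hyperplane_weights)
      then show "?w a \<in> {..<3}" by simp
    qed
  qed simp_all
  also have "\<dots> = (\<Sum>i<3. (int q ^ n - 1) * int (t i) * F (int q ^ (k - n) * int q ^ i))"
  proof (rule sum.cong[OF refl])
    fix i
    let ?A = "{a. a \<noteq> 0 \<and> weight_in \<phi> U (annihilator {a}) = k - n + i}"
    have A: "{a \<in> UNIV - {0}. ?w a = i} = ?A"
    proof -
      have "?w a = i \<longleftrightarrow> weight_in \<phi> U (annihilator {a}) = k - n + i" for a
      proof -
        obtain j where "weight_in \<phi> U (annihilator {a}) = k - n + j" by (rule cut_lower)
        then show ?thesis by simp
      qed
      then show ?thesis by simp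
    qed
    have "F (int (cut a)) = F (int q ^ (k - n) * int q ^ i)" if "a \<in> ?A" for a
      using that card_cut[OF subspace_annihilator, of "{a}"] by (simp add: power_add)
    then have "(\<Sum>a\<in>?A. F (int (cut a))) = int (card ?A) * F (int q ^ (k - n) * int q ^ i)"
      by simp
    also have "int (card ?A) = (int q ^ n - 1) * int (t i)"
      using q_gt_1 unfolding card_normals by (simp add: of_nat_diff)
    finally show "(\<Sum>a\<in>{a \<in> UNIV - {0}. ?w a = i}. F (int (cut a)))
        = (int q ^ n - 1) * int (t i) * F (int q ^ (k - n) * int q ^ i)"
      unfolding A .
  qed
  finally show ?thesis .
qed

text \<open>The first three moments are three linear equations for the numbers \<open>y i\<close> of normal vectors. The
  combination that isolates \<open>y i\<close> is the one given by the quadratic polynomial in \<open>f\<close> that vanishes at the two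
  other values.\<close>
lemma hyperplane_counts:
  defines "x \<equiv> int q" and "K \<equiv> int q ^ k" and "Q \<equiv> int q ^ n"
  shows "(x - 1)\<^sup>2 * (x + 1) * (Q - 1) * int (t 0)
      = (K - 1) * (K\<^sup>2 * x ^ 3 - K\<^sup>2 * x\<^sup>2 - K\<^sup>2 * x + K\<^sup>2 - K * Q * x\<^sup>2 + K * x ^ 3 - K * x + K * Q
          + Q\<^sup>2 - Q * x\<^sup>2 - Q * x + x ^ 3)" (is ?t0)
    and "(x - 1)\<^sup>2 * x * int (t 1) = (K - 1) * (K * x\<^sup>2 - K * x - Q + x\<^sup>2)" (is ?t1)
    and "(x - 1)\<^sup>2 * x * (x + 1) * int (t 2) = (Q - x) * (K - 1)" (is ?t2)
proof -
  define D where "D = int q ^ (k - n)"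
  define y where "y i = (Q - 1) * int (t i)" for i
  have K: "K = D * Q" using power_sizes(1) by (simp add: K_def D_def Q_def)
  have x: "x > 1" using q_gt_1 by (simp add: x_def)
  have D0: "D\<^sup>2 \<noteq> 0" using q_gt_1 by (simp add: D_def)
  have "1 < Q" using x n_ge by (simp add: Q_def x_def)
  then have Q0: "Q - 1 \<noteq> 0" by simp
  have y: "(\<Sum>a\<in>UNIV - {0}. F (int (cut a))) = y 0 * F D + y 1 * F (D * x) + y 2 * F (D * x\<^sup>2)" for F
    unfolding sum_over_cuts by (simp add: y_def Q_def D_def x_def numeral_3_eq_3 numeral_2_eq_2)
  have e0: "y 0 + y 1 + y 2 = K ^ 3 - 1"
    using y[of "\<lambda>_. 1"] unfolding low_moments(1) by (simp add: K D_def Q_def)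
  have e1: "y 0 * (D - 1) + y 1 * (D * x - 1) + y 2 * (D * x\<^sup>2 - 1) = (K - 1) * (D * K\<^sup>2 - 1)"
    using y[of "\<lambda>f. f - 1"] low_moments(2) by (simp add: K D_def Q_def)
  have e2: "y 0 * ((D - 1) * (D - x)) + y 1 * ((D * x - 1) * (D * x - x))
      + y 2 * ((D * x\<^sup>2 - 1) * (D * x\<^sup>2 - x)) = (K - 1) * (K - x) * (D\<^sup>2 * K - 1)"
    using y[of "\<lambda>f. (f - 1) * (f - x)"] low_moments(3) by (simp add: K D_def Q_def x_def)
  \<comment> \<open>The ordinary power sums of the section sizes, obtained from the factorial moments.\<close>
  define S1 where "S1 = (K - 1) * (D * K\<^sup>2 - 1) + (K ^ 3 - 1)"
  define S2 where "S2 = (K - 1) * (K - x) * (D\<^sup>2 * K - 1) + (1 + x) * S1 - x * (K ^ 3 - 1)"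
  have s1: "D * (y 0 + x * y 1 + x\<^sup>2 * y 2) = S1"
    unfolding S1_def using e0 e1 by algebra
  have s2: "D\<^sup>2 * (y 0 + x\<^sup>2 * y 1 + x ^ 4 * y 2) = S2"
    unfolding S2_def using e0 s1 e2 by algebra
  have "D\<^sup>2 * ((x - 1)\<^sup>2 * x * (x + 1) * y 2) = S2 - (1 + x) * D * S1 + x * D\<^sup>2 * (K ^ 3 - 1)"
    using e0 s1 s2 by algebra
  also have "\<dots> = D\<^sup>2 * ((Q - 1) * ((Q - x) * (K - 1)))"
    unfolding S1_def S2_def K by algebra
  finally have "(Q - 1) * ((x - 1)\<^sup>2 * x * (x + 1) * int (t 2)) = (Q - 1) * ((Q - x) * (K - 1))"
    using D0 by (simp add: y_def ac_simps)
  then show ?t2 using Q0 by simp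
  have "D\<^sup>2 * ((x - 1)\<^sup>2 * x * y 1) = - (S2 - (1 + x\<^sup>2) * D * S1 + x\<^sup>2 * D\<^sup>2 * (K ^ 3 - 1))"
    using e0 s1 s2 by algebra
  also have "\<dots> = D\<^sup>2 * ((Q - 1) * ((K - 1) * (K * x\<^sup>2 - K * x - Q + x\<^sup>2)))"
    unfolding S1_def S2_def K by algebra
  finally have "(Q - 1) * ((x - 1)\<^sup>2 * x * int (t 1)) = (Q - 1) * ((K - 1) * (K * x\<^sup>2 - K * x - Q + x\<^sup>2))"
    using D0 by (simp add: y_def ac_simps)
  then show ?t1 using Q0 by simp
  have "D\<^sup>2 * ((x - 1)\<^sup>2 * (x + 1) * y 0) = S2 - (x + x\<^sup>2) * D * S1 + x ^ 3 * D\<^sup>2 * (K ^ 3 - 1)"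
    using e0 s1 s2 by algebra
  also have "\<dots> = D\<^sup>2 * ((K - 1) * (K\<^sup>2 * x ^ 3 - K\<^sup>2 * x\<^sup>2 - K\<^sup>2 * x + K\<^sup>2 - K * Q * x\<^sup>2 + K * x ^ 3
      - K * x + K * Q + Q\<^sup>2 - Q * x\<^sup>2 - Q * x + x ^ 3))"
    unfolding S1_def S2_def K by algebra
  finally show ?t0
    using D0 unfolding y_def mult_cancel_left by (simp add: mult.assoc)
qed

text \<open>All three weights really occur. The inequalities come from \<open>2 \<le> x < Q \<le> K\<close>; each polynomial is
  rearranged into a sum of terms that are visibly nonnegative, with at least one positive.\<close>
lemma hyperplane_count_pos:
  assumes "i < 3"
  shows "0 < t i"
proof -
  have pos: "0 < m" if "c * int m = b" "0 < b" for c b m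
    using that by (cases m) auto
  define x K Q where "x = int q" and "K = int q ^ k" and "Q = int q ^ n"
  have x: "2 \<le> x" using q_gt_1 by (simp add: x_def)
  have "x ^ 3 \<le> Q" using x n_ge by (simp add: Q_def x_def power_increasing)
  moreover have QK: "Q \<le> K" using n_le_k q_gt_1 by (simp add: Q_def K_def power_increasing)
  moreover have "x < x ^ 3" using power_strict_increasing[of 1 3 x] x by simp
  ultimately have xQ: "x < Q" and K: "1 < K" using x by linarith+
  have "0 < (Q - x) * (K - 1)" using xQ K by simp
  then have t2: "0 < t 2"
    unfolding x_def K_def Q_def by (rule pos[OF hyperplane_counts(3)])
  have "0 \<le> (K - Q) + K * (x - 2) + K * (x - 1) * (x - 1)"
    using QK K x by (intro add_nonneg_nonneg mult_nonneg_nonneg) auto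
  then have "0 < K * x\<^sup>2 - K * x - Q + x\<^sup>2"
    using x by (simp add: power2_eq_square algebra_simps) (smt (verit) mult_pos_pos)
  then have "0 < (K - 1) * (K * x\<^sup>2 - K * x - Q + x\<^sup>2)" using K by simp
  then have t1: "0 < t 1"
    unfolding x_def K_def Q_def by (rule pos[OF hyperplane_counts(2)])
  have "K\<^sup>2 * x ^ 3 - K\<^sup>2 * x\<^sup>2 - K\<^sup>2 * x + K\<^sup>2 - K * Q * x\<^sup>2 + K * x ^ 3 - K * x + K * Q
          + Q\<^sup>2 - Q * x\<^sup>2 - Q * x + x ^ 3
      = (x\<^sup>2 - 1) * (K * (K * (x - 2) + (K - Q))) + x * (x\<^sup>2 - 1) * (K - Q) + Q * x * ((x - 2) * (x + 1))
        + Q\<^sup>2 + x ^ 3"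
    by algebra
  also have "\<dots> > 0"
  proof -
    have "0 \<le> x\<^sup>2 - 1" using x by (simp add: power2_eq_square)
    then have "0 \<le> (x\<^sup>2 - 1) * (K * (K * (x - 2) + (K - Q)))" "0 \<le> x * (x\<^sup>2 - 1) * (K - Q)"
        "0 \<le> Q * x * ((x - 2) * (x + 1))"
      using x K QK xQ by simp_all
    moreover have "0 < x ^ 3" using x by simp
    ultimately show ?thesis by (smt (verit) zero_le_power2)
  qed
  finally have "0 < (K - 1) * (K\<^sup>2 * x ^ 3 - K\<^sup>2 * x\<^sup>2 - K\<^sup>2 * x + K\<^sup>2 - K * Q * x\<^sup>2 + K * x ^ 3 - K * x
      + K * Q + Q\<^sup>2 - Q * x\<^sup>2 - Q * x + x ^ 3)" using K by simp
  then have t0: "0 < t 0"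
    unfolding x_def K_def Q_def by (rule pos[OF hyperplane_counts(1)])
  from assms have "i = 0 \<or> i = 1 \<or> i = 2" by linarith
  then show ?thesis using t0 t1 t2 by auto
qed

end

section \<open>The points of the linear set\<close>

lemma embedding_nonzero:
  assumes "field_embedding \<phi>" and "c \<noteq> 0"
  shows "\<phi> c \<noteq> 0"
proof
  assume "\<phi> c = 0"
  then have "\<phi> (c * inverse c) = 0"
    using assms(1) by (simp only: field_embedding_def mult_zero_left)
  then show False using assms by (simp add: field_embedding_def)
qed

lemma embedding_inj:
  assumes "field_embedding \<phi>"
  shows "inj \<phi>"
proof (rule injI)
  fix c d assume eq: "\<phi> c = \<phi> d"
  have "\<phi> (c - d + d) = \<phi> (c - d) + \<phi> d"
    using assms unfolding field_embedding_def by blast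
  then have "\<phi> (c - d) = 0" using eq by simp
  then show "c = d" using embedding_nonzero[OF assms, of "c - d"] by auto
qed

lemma proj_point_subset_iff: "vec.subspace W \<Longrightarrow> proj_point v \<subseteq> W \<longleftrightarrow> v \<in> W"
  unfolding proj_point_def using vec.span_minimal[of "{v}" W] vec.span_base[of v "{v}"] by blast

context max_two_scattered
begin

text \<open>Two vectors of \<open>U\<close> that span the same point are dependent over the large field, hence already over the
  small one; so the vectors of \<open>U\<close> over a point are the small-field multiples of any one of
  them.\<close>
lemma point_weight_one:
  assumes u: "u \<in> U - {0}"
  shows "{v \<in> U - {0}. proj_point v = proj_point u} = (\<lambda>c. sub_scale \<phi> c u) ` (UNIV - {0})"
proof
  show "(\<lambda>c. sub_scale \<phi> c u) ` (UNIV - {0}) \<subseteq> {v \<in> U - {0}. proj_point v = proj_point u}"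
  proof (rule image_subsetI)
    fix c :: 'k assume "c \<in> UNIV - {0}"
    then have c: "\<phi> c \<noteq> 0" using embedding_nonzero[OF embedding] by simp
    have "sub_scale \<phi> c u \<in> U" using u sub.subspace_scale[OF subspace_U] by blast
    moreover have "sub_scale \<phi> c u \<noteq> 0" using u c by (simp add: sub_scale_def)
    moreover have "proj_point (sub_scale \<phi> c u) = proj_point u"
      unfolding proj_point_def sub_scale_def vec.span_eq
    proof
      show "{\<phi> c *s u} \<subseteq> vec.span {u}" by (simp add: vec.span_scale vec.span_base)
      have "inverse (\<phi> c) *s (\<phi> c *s u) \<in> vec.span {\<phi> c *s u}"
        by (intro vec.span_scale vec.span_base) simp
      then show "{u} \<subseteq> vec.span {\<phi> c *s u}" using c by (simp add: vector_smult_assoc)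
    qed
    ultimately show "sub_scale \<phi> c u \<in> {v \<in> U - {0}. proj_point v = proj_point u}" by simp
  qed
  show "{v \<in> U - {0}. proj_point v = proj_point u} \<subseteq> (\<lambda>c. sub_scale \<phi> c u) ` (UNIV - {0})"
  proof
    fix v assume v: "v \<in> {v \<in> U - {0}. proj_point v = proj_point u}"
    have "v \<in> sub.span {u}"
    proof (rule ccontr)
      assume nv: "v \<notin> sub.span {u}"
      then have ne: "v \<noteq> u" using sub.span_base[of u "{u}"] by auto
      have "sub.independent {u}" using u sub.dependent_single by auto
      then have "sub.independent {v, u}" using nv by (rule sub.independent_insertI[rotated])
      moreover have "card {v, u} \<le> 3" using ne by simp
      ultimately have "vec.independent {v, u}"
        using u v by (intro independent_over_extension) auto
      then have "v \<notin> vec.span {u}" using ne vec.independent_insert[of v "{u}"] by simp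
      moreover have "v \<in> vec.span {u}"
        using v vec.span_base[of v "{v}"] by (simp add: proj_point_def)
      ultimately show False by simp
    qed
    then obtain c where c: "v = sub_scale \<phi> c u"
      unfolding sub.span_singleton by blast
    moreover have "c \<noteq> 0" using c v by auto
    ultimately show "v \<in> (\<lambda>c. sub_scale \<phi> c u) ` (UNIV - {0})" by blast
  qed
qed

lemma card_points_in:
  assumes W: "vec.subspace W"
  shows "(q - 1) * card {P \<in> linear_set U. P \<subseteq> W} = q ^ weight_in \<phi> U W - 1"
proof -
  let ?P = "{P \<in> linear_set U. P \<subseteq> W}"
  have "card (W \<inter> U - {0}) = (\<Sum>v\<in>W \<inter> U - {0}. 1)" by simp
  also have "\<dots> = (\<Sum>P\<in>?P. \<Sum>v\<in>{v \<in> W \<inter> U - {0}. proj_point v = P}. 1)"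
  proof (rule sum.group[symmetric])
    show "proj_point ` (W \<inter> U - {0}) \<subseteq> ?P"
      unfolding linear_set_def using proj_point_subset_iff[OF W] by blast
  qed simp_all
  also have "\<dots> = (\<Sum>P\<in>?P. q - 1)"
  proof (rule sum.cong[OF refl])
    fix P assume "P \<in> ?P"
    then obtain u where u: "u \<in> U - {0}" "P = proj_point u" "u \<in> W"
      unfolding linear_set_def using proj_point_subset_iff[OF W] by blast
    have "{v \<in> W \<inter> U - {0}. proj_point v = P} = {v \<in> U - {0}. proj_point v = proj_point u}"
      using u proj_point_subset_iff[OF W] by auto
    also have "\<dots> = (\<lambda>c. sub_scale \<phi> c u) ` (UNIV - {0})"
      by (rule point_weight_one) (rule u)
    also have "card \<dots> = q - 1"
    proof -
      have "inj_on (\<lambda>c. sub_scale \<phi> c u) (UNIV - {0})"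
        using u(1) by (simp add: inj_on_def sub_scale_def inj_eq[OF embedding_inj[OF embedding]])
      then show ?thesis by (simp add: card_image card_base card_Diff_singleton)
    qed
    finally show "(\<Sum>v\<in>{v \<in> W \<inter> U - {0}. proj_point v = P}. 1) = q - 1" by simp
  qed
  finally have "card (W \<inter> U - {0}) = (q - 1) * card ?P" by simp
  moreover have "0 \<in> W \<inter> U" using vec.subspace_0[OF W] sub.subspace_0[OF subspace_U] by simp
  ultimately show ?thesis using card_cut[OF W] by simp
qed

lemma card_points_eq_theta:
  assumes W: "vec.subspace W"
  shows "card {P \<in> linear_set U. P \<subseteq> W} = theta q (int (weight_in \<phi> U W) - 1)"
proof -
  have "theta q (int (weight_in \<phi> U W) - 1)
      = (q - 1) * card {P \<in> linear_set U. P \<subseteq> W} div (q - 1)"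
    unfolding card_points_in[OF W] theta_def by simp
  then show ?thesis using q_gt_1 by simp
qed

lemma card_linear_set:
  "(q - 1) * card (linear_set U) = q ^ k - 1" "card (linear_set U) = theta q (int k - 1)"
proof -
  have all: "{P \<in> linear_set U. P \<subseteq> UNIV} = linear_set U" by blast
  have weight: "weight_in \<phi> U UNIV = k" unfolding weight_in_def Int_UNIV_left rank_def ..
  show "(q - 1) * card (linear_set U) = q ^ k - 1" "card (linear_set U) = theta q (int k - 1)"
    using card_points_in[OF vec.subspace_UNIV] card_points_eq_theta[OF vec.subspace_UNIV]
    unfolding all weight .
qed

end

section \<open>The code as the image of the dual space\<close>

lemma theta_strict_mono:
  assumes q: "1 < q" and "i < j"
  shows "theta q (int i - 1) < theta q (int j - 1)"
proof -
  have theta: "(q - 1) * theta q (int m - 1) = q ^ m - 1" for m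
  proof -
    have "int q - 1 dvd int q ^ m - 1" unfolding power_diff_1_eq by (rule dvd_triv_left)
    moreover have "int q - 1 = int (q - 1)" "int q ^ m - 1 = int (q ^ m - 1)"
      using q by (simp_all add: of_nat_diff)
    ultimately have "q - 1 dvd q ^ m - 1" by (simp only: of_nat_dvd_iff)
    then show ?thesis by (simp add: theta_def)
  qed
  have "q ^ i < q ^ j" using assms by (simp add: power_strict_increasing)
  moreover have "1 \<le> q ^ i" using q by simp
  ultimately have "(q - 1) * theta q (int i - 1) < (q - 1) * theta q (int j - 1)"
    unfolding theta by linarith
  then show ?thesis by simp
qed

lemma scalar_product_axis: "scalar_product (axis j 1) (v :: 'a::field ^ 'r::finite) = v $ j"
  by (simp add: scalar_product_def axis_def if_distrib[of "\<lambda>x. x * _"] cong: if_cong)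

lemma hamming_weight_0: "hamming_weight N (0 :: nat \<Rightarrow> 'a::zero) = 0"
  by (simp add: hamming_weight_def)

definition codeword :: "nat \<Rightarrow> (nat \<Rightarrow> 'a::field ^ 'r::finite) \<Rightarrow> 'a ^ 'r \<Rightarrow> nat \<Rightarrow> 'a" where
  "codeword N g a = (\<lambda>i. if i \<in> {1..N} then scalar_product a (g i) else 0)"

interpretation word: vector_space "word_scale :: 'a::field \<Rightarrow> _"
  by (rule vector_space_word_scale)

lemma codeword_diff: "codeword N g a - codeword N g b = codeword N g (a - b)"
  by (auto simp: codeword_def fun_eq_iff scalar_product_def left_diff_distrib sum_subtractf)

lemma subspace_codewords: "word.subspace (range (codeword N g))"
proof (rule word.subspaceI)
  have "codeword N g 0 = 0" by (auto simp: codeword_def fun_eq_iff scalar_product_def)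
  then show "0 \<in> range (codeword N g)" by (metis rangeI)
next
  fix x y assume "x \<in> range (codeword N g)" "y \<in> range (codeword N g)"
  then obtain a b where "x = codeword N g a" "y = codeword N g b" by blast
  then have "x + y = codeword N g (a + b)"
    by (auto simp: codeword_def fun_eq_iff scalar_product_def distrib_right sum.distrib)
  then show "x + y \<in> range (codeword N g)" by blast
next
  fix c x assume "x \<in> range (codeword N g)"
  then obtain a where "x = codeword N g a" by blast
  then have "word_scale c x = codeword N g (c *s a)"
    by (auto simp: codeword_def word_scale_def fun_eq_iff scalar_product_def sum_distrib_left mult.assoc)
  then show "word_scale c x \<in> range (codeword N g)" by blast
qed

text \<open>The row space consists of the evaluations of all linear functionals at the columns: row \<open>j\<close> is the
  functional of the \<open>j\<close>-th unit vector.\<close>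
lemma generated_code_eq_codewords: "generated_code N g = range (codeword N g)"
  unfolding generated_code_def
proof
  show "word.span (range (matrix_row N g)) \<subseteq> range (codeword N g)"
  proof (rule word.span_minimal[OF _ subspace_codewords])
    have "matrix_row N g j = codeword N g (axis j 1)" for j
      by (auto simp: fun_eq_iff matrix_row_def codeword_def scalar_product_axis)
    then show "range (matrix_row N g) \<subseteq> range (codeword N g)" by auto
  qed
  show "range (codeword N g) \<subseteq> word.span (range (matrix_row N g))"
  proof (rule image_subsetI)
    fix a
    have apply_sum: "(\<Sum>j\<in>J. f j) i = (\<Sum>j\<in>J. f j i)" for J and f :: "'b \<Rightarrow> nat \<Rightarrow> 'a" and i
      by (induction J rule: infinite_finite_induct) simp_all
    have "codeword N g a = (\<Sum>j\<in>UNIV. word_scale (a $ j) (matrix_row N g j))"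
      by (auto simp: fun_eq_iff apply_sum codeword_def word_scale_def matrix_row_def scalar_product_def)
    also have "\<dots> \<in> word.span (range (matrix_row N g))"
      by (intro word.span_sum word.span_scale word.span_base rangeI)
    finally show "codeword N g a \<in> word.span (range (matrix_row N g))" .
  qed
qed

lemma linear_generated_code: "linear_code N (generated_code N g)"
  unfolding linear_code_def
proof
  show "word.subspace (generated_code N g)" by (simp add: generated_code_def)
  show "\<forall>c\<in>generated_code N g. \<forall>i. i \<notin> {1..N} \<longrightarrow> c i = 0"
    by (auto simp: generated_code_eq_codewords codeword_def)
qed

lemma hamming_weight_codeword:
  assumes g: "point_representatives U N g"
  shows "hamming_weight N (codeword N g a)
    = card (linear_set U) - card {P \<in> linear_set U. P \<subseteq> annihilator {a}}"
proof -
  let ?Z = "{P \<in> linear_set U. P \<subseteq> annihilator {a}}"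
  have bij: "bij_betw (\<lambda>i. proj_point (g i)) {1..N} (linear_set U)"
    using g by (simp add: point_representatives_def)
  have fin: "finite (linear_set U)" using bij_betw_finite[OF bij] by simp
  have "bij_betw (\<lambda>i. proj_point (g i)) {i \<in> {1..N}. codeword N g a i \<noteq> 0} (linear_set U - ?Z)"
  proof (rule bij_betw_subset[OF bij])
    have vanish: "codeword N g a i = 0 \<longleftrightarrow> proj_point (g i) \<subseteq> annihilator {a}" if "i \<in> {1..N}" for i
      using that proj_point_subset_iff[OF subspace_annihilator, of "g i" "{a}"]
      by (simp add: codeword_def annihilator_def scalar_product_commute)
    have im: "linear_set U = (\<lambda>i. proj_point (g i)) ` {1..N}"
      using bij by (simp add: bij_betw_def)
    show "(\<lambda>i. proj_point (g i)) ` {i \<in> {1..N}. codeword N g a i \<noteq> 0} = linear_set U - ?Z"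
      unfolding im using vanish by blast
  qed blast
  then have "hamming_weight N (codeword N g a) = card (linear_set U - ?Z)"
    unfolding hamming_weight_def by (rule bij_betw_same_card)
  also have "\<dots> = card (linear_set U) - card ?Z"
    by (rule card_Diff_subset) (use fin in auto)
  finally show ?thesis .
qed

section \<open>The weights of the code\<close>

context max_two_scattered
begin

text \<open>The number of points off a hyperplane of weight \<open>k - n + i\<close>.\<close>
definition weight_value :: "nat \<Rightarrow> nat" where
  "weight_value i = card (linear_set U) - theta q (int (k - n + i) - 1)"

text \<open>Positivity uses \<open>n \<ge> 3\<close>: even a hyperplane of the largest weight \<open>k - n + 2\<close> misses part of
  \<open>U\<close>.\<close>
lemma weight_value:
  assumes "j < 3"
  shows "0 < weight_value j" and "weight_value j \<le> card (linear_set U)"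
    and "i < j \<Longrightarrow> weight_value j < weight_value i"
proof -
  have "theta q (int (k - n + j) - 1) < card (linear_set U)"
    unfolding card_linear_set(2)
    using assms n_ge n_le_k by (intro theta_strict_mono q_gt_1) linarith
  moreover have "i < j \<Longrightarrow> theta q (int (k - n + i) - 1) < theta q (int (k - n + j) - 1)"
    by (intro theta_strict_mono q_gt_1) simp
  ultimately show "0 < weight_value j" "weight_value j \<le> card (linear_set U)"
      "i < j \<Longrightarrow> weight_value j < weight_value i"
    unfolding weight_value_def by linarith+
qed

lemma weight_value_eq_iff: "i < 3 \<Longrightarrow> j < 3 \<Longrightarrow> weight_value i = weight_value j \<longleftrightarrow> i = j"
  using weight_value(3)[of i j] weight_value(3)[of j i] by (metis less_irrefl linorder_neqE_nat)

context
  fixes N and g :: "nat \<Rightarrow> 'a ^ 'r"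
  assumes g: "point_representatives U N g"
begin

lemma hamming_weight_eq:
  assumes "weight_in \<phi> U (annihilator {a}) = k - n + i"
  shows "hamming_weight N (codeword N g a) = weight_value i"
  unfolding hamming_weight_codeword[OF g] card_points_eq_theta[OF subspace_annihilator] assms
    weight_value_def ..

lemma length_eq: "N = card (linear_set U)"
  using bij_betw_same_card[of _ "{1..N}" "linear_set U"] g
  by (simp add: point_representatives_def) 

lemma codeword_weights:
  assumes "a \<noteq> 0"
  obtains i where "i < 3" "hamming_weight N (codeword N g a) = weight_value i"
    "weight_in \<phi> U (annihilator {a}) = k - n + i"
  using hyperplane_weights[OF assms] hamming_weight_eq by metis

text \<open>A nonzero functional gives a word of positive weight, so no functional vanishes on the whole linear
  set and the code has full dimension.\<close>
lemma inj_codeword: "inj (codeword N g)"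
proof (rule injI, rule ccontr)
  fix a b assume eq: "codeword N g a = codeword N g b" and "a \<noteq> b"
  then have "a - b \<noteq> 0" by simp
  then obtain i where "i < 3" "hamming_weight N (codeword N g (a - b)) = weight_value i"
    by (rule codeword_weights)
  moreover have "codeword N g (a - b) = 0"
    using codeword_diff[of N g a b] eq by simp
  ultimately show False using weight_value(1)[of i] by (simp add: hamming_weight_0)
qed

lemma codewords_of_weight:
  assumes "0 < w"
  shows "card {c \<in> generated_code N g. hamming_weight N c = w}
    = card {a. a \<noteq> 0 \<and> hamming_weight N (codeword N g a) = w}"
proof -
  have "codeword N g 0 = 0" by (auto simp: codeword_def fun_eq_iff scalar_product_def)
  then have "a \<noteq> 0" if "hamming_weight N (codeword N g a) = w" for a
    using assms that hamming_weight_0[of N, where 'a = 'a] by auto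
  then have "{c \<in> generated_code N g. hamming_weight N c = w}
      = codeword N g ` {a. a \<noteq> 0 \<and> hamming_weight N (codeword N g a) = w}"
    unfolding generated_code_eq_codewords by blast
  then show ?thesis
    using inj_codeword by (simp add: card_image inj_on_subset)
qed

lemma codewords_of_weight_value:
  assumes i: "i < 3"
  shows "card {c \<in> generated_code N g. hamming_weight N c = weight_value i} = (q ^ n - 1) * t i"
proof -
  have "hamming_weight N (codeword N g a) = weight_value i
      \<longleftrightarrow> weight_in \<phi> U (annihilator {a}) = k - n + i" if "a \<noteq> 0" for a
    using codeword_weights[OF that] hamming_weight_eq weight_value_eq_iff[OF _ i] by metis
  then show ?thesis
    unfolding codewords_of_weight[OF weight_value(1)[OF i]] card_normals[symmetric]
    by (intro arg_cong[of _ _ card]) blast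
qed

lemma no_codewords_of_other_weight:
  assumes "0 < w" and "\<And>i. i < 3 \<Longrightarrow> w \<noteq> weight_value i"
  shows "card {c \<in> generated_code N g. hamming_weight N c = w} = 0"
  unfolding codewords_of_weight[OF assms(1)] using codeword_weights assms(2)
  by (metis (mono_tags, lifting) card.empty empty_Collect_eq)

lemma nonzero_weights_eq: "nonzero_weights N (generated_code N g) = weight_value ` {..<3}"
proof
  show "nonzero_weights N (generated_code N g) \<subseteq> weight_value ` {..<3}"
    unfolding nonzero_weights_def generated_code_eq_codewords
  proof (rule image_subsetI)
    fix c assume c: "c \<in> range (codeword N g) - {0}"
    then obtain a where a: "c = codeword N g a" by blast
    have "codeword N g 0 = 0" by (auto simp: codeword_def fun_eq_iff scalar_product_def)
    then have "a \<noteq> 0" using a c by auto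
    then show "hamming_weight N c \<in> weight_value ` {..<3}"
      unfolding a by (rule codeword_weights) simp
  qed
  show "weight_value ` {..<3} \<subseteq> nonzero_weights N (generated_code N g)"
  proof (rule image_subsetI)
    fix i :: nat assume "i \<in> {..<3}"
    then have i: "i < 3" by simp
    have "1 < q ^ n" using q_gt_1 n_ge by (intro one_less_power) auto
    then have "card {c \<in> generated_code N g. hamming_weight N c = weight_value i} \<noteq> 0"
      using codewords_of_weight_value[OF i] hyperplane_count_pos[OF i] by simp
    then obtain c where c: "c \<in> generated_code N g" "hamming_weight N c = weight_value i"
      by (metis (mono_tags, lifting) card.empty empty_Collect_eq)
    then have "c \<noteq> 0" using weight_value(1)[OF i] by (auto simp: hamming_weight_0)
    with c show "weight_value i \<in> nonzero_weights N (generated_code N g)"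
      unfolding nonzero_weights_def by (metis DiffI imageI singletonD)
  qed
qed

lemma three_weights: "three_weight_code N (generated_code N g)"
proof -
  have "inj_on weight_value {..<3}" using weight_value_eq_iff by (simp add: inj_on_def)
  then show ?thesis
    unfolding three_weight_code_def nonzero_weights_eq
    by (simp add: linear_generated_code card_image)
qed

lemma weight_enumerator_eq:
  "weight_enumerator N (generated_code N g)
    = 1 + (\<Sum>i<3. monom ((int q ^ n - 1) * int (t i)) (weight_value i))"
proof -
  let ?A = "\<lambda>w. int (card {c \<in> generated_code N g. hamming_weight N c = w})"
  have "(\<Sum>w = 1..N. monom (?A w) w) = (\<Sum>w\<in>weight_value ` {..<3}. monom (?A w) w)"
  proof (rule sum.mono_neutral_right)
    show "weight_value ` {..<3} \<subseteq> {1..N}"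
      using weight_value(1,2) length_eq by (fastforce simp: Suc_le_eq)
    show "\<forall>w\<in>{1..N} - weight_value ` {..<3}. monom (?A w) w = 0"
    proof
      fix w assume "w \<in> {1..N} - weight_value ` {..<3}"
      then have "card {c \<in> generated_code N g. hamming_weight N c = w} = 0"
        by (intro no_codewords_of_other_weight) auto
      then show "monom (?A w) w = 0" by simp
    qed
  qed simp
  also have "\<dots> = (\<Sum>i<3. monom (?A (weight_value i)) (weight_value i))"
    by (rule sum.reindex_cong[of weight_value]) (auto simp: inj_on_def weight_value_eq_iff)
  also have "\<dots> = (\<Sum>i<3. monom ((int q ^ n - 1) * int (t i)) (weight_value i))"
  proof (rule sum.cong[OF refl])
    fix i :: nat assume "i \<in> {..<3}"
    then have "?A (weight_value i) = (int q ^ n - 1) * int (t i)"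
      using codewords_of_weight_value[of i] q_gt_1 by (simp add: of_nat_diff)
    then show "monom (?A (weight_value i)) (weight_value i)
        = monom ((int q ^ n - 1) * int (t i)) (weight_value i)" by simp
  qed
  finally show ?thesis unfolding weight_enumerator_def by simp
qed

end

end

theorem corollary6p5:
  fixes \<phi> :: "'k::{field,finite} \<Rightarrow> 'a::{field,finite}"
    and U :: "('a ^ 'r::finite) set"
    and g :: "nat \<Rightarrow> 'a ^ 'r"
    and C :: "(nat \<Rightarrow> 'a) set"
    and t :: "nat \<Rightarrow> nat"
    and q r n N w0 w1 w2 :: nat
  assumes "CARD('k) = q" and "CARD('a) = q ^ n" and "field_embedding \<phi>"
    and "CARD('r) = r"
    and "r \<ge> 3" and "n \<ge> 3" and "3 dvd r * n"
    and "maximum_two_scattered \<phi> n U"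
    and "N = card (linear_set U)"
    and "point_representatives U N g"
    and "C = generated_code N g"
    and "t = hyperplane_count \<phi> n U"
    and "w0 = N - theta q (int ((r - 3) * n div 3) - 1)"
    and "w1 = N - theta q (int ((r - 3) * n div 3))"
    and "w2 = N - theta q (int ((r - 3) * n div 3) + 1)"
  shows "real N = (real q ^ (r * n div 3) - 1) / (real q - 1)
    \<and> three_weight_code N C \<and> nonzero_weights N C = {w0, w1, w2}
    \<and> weight_enumerator N C =
        1 + monom ((int q ^ n - 1) * int (t 0)) w0
          + monom ((int q ^ n - 1) * int (t 1)) w1
          + monom ((int q ^ n - 1) * int (t 2)) w2
    \<and> (let x = real q; h = r * n div 3;
           t0_star = x ^ (2 * h + 3) - x ^ (2 * h + 2) - x ^ (2 * h + 1) + x ^ (2 * h)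
             - x ^ (h + n + 2) + x ^ (h + 3) - x ^ (h + 1) + x ^ (h + n)
             + x ^ (2 * n) - x ^ (n + 2) - x ^ (n + 1) + x ^ 3
       in real (t 0) = (x ^ h - 1) / ((x - 1)\<^sup>2 * (x + 1) * (x ^ n - 1)) * t0_star
        \<and> real (t 1) = (x ^ h - 1) * (x ^ (h + 2) - x ^ (h + 1) - x ^ n + x\<^sup>2)
            / ((x - 1)\<^sup>2 * x)
        \<and> real (t 2) = (x ^ n - x) * (x ^ h - 1) / ((x - 1)\<^sup>2 * x * (x + 1)))"
proof -
  define k where "k = sub_dim \<phi> U"
  interpret max_two_scattered \<phi> q n k U
    using assms k_def by unfold_locales simp_all
  note g = \<open>point_representatives U N g\<close>
  have h: "r * n div 3 = k" using rank \<open>CARD('r) = r\<close> by simp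
  have generic: "(r - 3) * n div 3 = k - n" using generic_weight \<open>CARD('r) = r\<close> by simp
  have w: "w0 = weight_value 0" "w1 = weight_value 1" "w2 = weight_value 2"
    unfolding assms(13-15) generic weight_value_def \<open>N = card (linear_set U)\<close> by (simp_all add: add.commute)
  have below_3: "{..<3::nat} = {0, 1, 2}" by auto
  have weights: "nonzero_weights N C = {w0, w1, w2}"
    unfolding \<open>C = generated_code N g\<close> nonzero_weights_eq[OF g] below_3 w by simp
  have enumerator: "weight_enumerator N C =
        1 + monom ((int q ^ n - 1) * int (t 0)) w0
          + monom ((int q ^ n - 1) * int (t 1)) w1
          + monom ((int q ^ n - 1) * int (t 2)) w2"
    unfolding \<open>C = generated_code N g\<close> weight_enumerator_eq[OF g] below_3 w
      \<open>t = hyperplane_count \<phi> n U\<close>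
    by (simp add: add.assoc)
  define x K Q where "x = real q" and "K = x ^ k" and "Q = x ^ n"
  have x: "1 < x" using q_gt_1 by (simp add: x_def)
  have "1 < Q" unfolding Q_def using x n_ge by (intro one_less_power) auto
  have "real ((q - 1) * N) = real (q ^ k - 1)"
    using card_linear_set(1) \<open>N = card (linear_set U)\<close> by simp
  then have "(x - 1) * real N = K - 1"
    using q_gt_1 by (simp add: x_def K_def of_nat_diff)
  then have length: "real N = (K - 1) / (x - 1)"
    using x by (simp add: field_simps)
  note counts = hyperplane_counts[THEN arg_cong[of _ _ real_of_int], folded \<open>t = hyperplane_count \<phi> n U\<close>]
  have K2: "x ^ (2 * k) = K\<^sup>2" "x ^ (2 * n) = Q\<^sup>2"
    unfolding K_def Q_def by (simp_all only: mult.commute[of 2] power_mult)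
  have t0: "real (t 0) = (K - 1) / ((x - 1)\<^sup>2 * (x + 1) * (Q - 1))
      * (x ^ (2 * k + 3) - x ^ (2 * k + 2) - x ^ (2 * k + 1) + x ^ (2 * k)
         - x ^ (k + n + 2) + x ^ (k + 3) - x ^ (k + 1) + x ^ (k + n)
         + x ^ (2 * n) - x ^ (n + 2) - x ^ (n + 1) + x ^ 3)"
  proof -
    have "(x - 1)\<^sup>2 * (x + 1) * (Q - 1) * real (t 0)
      = (K - 1) * (K\<^sup>2 * x ^ 3 - K\<^sup>2 * x\<^sup>2 - K\<^sup>2 * x + K\<^sup>2 - K * Q * x\<^sup>2 + K * x ^ 3 - K * x + K * Q
          + Q\<^sup>2 - Q * x\<^sup>2 - Q * x + x ^ 3)"
      using counts(1) by (simp add: x_def K_def Q_def)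
    moreover have "(x - 1)\<^sup>2 * (x + 1) * (Q - 1) \<noteq> 0" using x \<open>1 < Q\<close> by simp
    ultimately show ?thesis
      unfolding power_add K2 K_def[symmetric] Q_def[symmetric] power_one_right
      by (simp add: nonzero_eq_divide_eq mult.commute)
  qed
  have t1: "real (t 1) = (K - 1) * (x ^ (k + 2) - x ^ (k + 1) - Q + x\<^sup>2) / ((x - 1)\<^sup>2 * x)"
  proof -
    have "(x - 1)\<^sup>2 * x * real (t 1) = (K - 1) * (K * x\<^sup>2 - K * x - Q + x\<^sup>2)"
      using counts(2) by (simp add: x_def K_def Q_def)
    moreover have "(x - 1)\<^sup>2 * x \<noteq> 0" using x by simp
    ultimately show ?thesis
      unfolding power_add K_def[symmetric] power_one_right
      by (simp add: nonzero_eq_divide_eq mult.commute)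
  qed
  have t2: "real (t 2) = (Q - x) * (K - 1) / ((x - 1)\<^sup>2 * x * (x + 1))"
  proof -
    have "(x - 1)\<^sup>2 * x * (x + 1) * real (t 2) = (Q - x) * (K - 1)"
      using counts(3) by (simp add: x_def K_def Q_def)
    moreover have "(x - 1)\<^sup>2 * x * (x + 1) \<noteq> 0" using x by simp
    ultimately show ?thesis
      by (simp add: nonzero_eq_divide_eq mult.commute)
  qed
  show ?thesis
    unfolding Let_def h
    using length three_weights[OF g] weights enumerator t0 t1 t2
    unfolding x_def K_def Q_def \<open>C = generated_code N g\<close> by blast
qed

end
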